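(* Let $a:[0,1]\to[0,1]$ and $\psi:[0,1]\to[0,\infty)$ be functions, let $w_0,w_4\ge 0$ with $w_0+w_4=1$, and let $m>0$. Define, for $x,y\in[0,1]$, $$r(x,y)=xy+a(x)a(y)\bigl(\min(x,y)-xy\bigr),\qquad K(x,y)=h(r(x,y)).$$ Suppose that for every $x,y\in[0,1]$, $$K(x,y)\ge\psi(x)\psi(y)\qquad\text{and}\qquad 2m\bigl[w_0h(xy)+w_4\psi(x)\psi(y)\bigr]\ge xh(y)+yh(x).$$ Then $$1-m\le C_*:=\frac12-\max_{0<q<1}\frac{qh(q)-\frac12h(q^2)}{\ln 2}.$$ Moreover, the maximum over $q\in(0,1)$ occurs at the unique solution $q_*\in(0,1)$ of $$(1-q)\ln(1-q)+q\ln(1+q)=0,$$ and $$C_*=\frac12-\frac{(1-q_* )\ln(1+q_* )}{2\ln 2}.$$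
   Context: $h(x)=-x\ln x-(1-x)\ln(1-x)$ for $x\in[0,1]$ is the binary entropy function with natural logarithms, with $0\ln 0:=0$ (so $h(0)=h(1)=0$). *)

theory Defs
  imports Complex_Main
begin

text \<open>Binary entropy in nats, meant for arguments in the unit interval. The convention
  \<open>0 ln 0 = 0\<close> needs no case distinction, as \<open>0 * ln 0 = 0\<close> in HOL.\<close>

definition h :: "real \<Rightarrow> real" where
  "h x = - x * ln x - (1 - x) * ln (1 - x)"

definition r :: "(real \<Rightarrow> real) \<Rightarrow> real \<Rightarrow> real \<Rightarrow> real" where
  "r a x y = x * y + a x * a y * (min x y - x * y)"

definition K :: "(real \<Rightarrow> real) \<Rightarrow> real \<Rightarrow> real \<Rightarrow> real" where
  "K a x y = h (r a x y)"

definition gain :: "real \<Rightarrow> real" where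
  "gain q = (q * h q - 1/2 * h (q\<^sup>2)) / ln 2"

text \<open>On an infinite set the maximum has to be written as a supremum. This is the intended
  value only if the supremum is attained, so attainment must be asserted along with any
  claim about this constant.\<close>

definition C_star :: real where
  "C_star = 1/2 - (SUP q\<in>{0<..<1}. gain q)"

end

theory Submission
  imports Defs
begin

text \<open>
  The bound on \<open>m\<close> comes from two points and the diagonal of the unit square. At \<open>(1, 1)\<close> the kernel is
  \<open>h 1 = 0\<close>, so \<open>\<psi> 1 = 0\<close>. At \<open>(1, 1/2)\<close> the second hypothesis then has no \<open>\<psi>\<close> term and becomes
  \<open>2 m w0 \<ge> 1\<close>. At \<open>(q, q)\<close> the first hypothesis and \<open>h \<le> ln 2\<close> give \<open>(\<psi> q)\<^sup>2 \<le> ln 2\<close>, so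
  the second gives \<open>q h q \<le> m w0 h (q\<^sup>2) + (m - m w0) ln 2\<close>. As \<open>h (q\<^sup>2) \<le> ln 2\<close>, the right-hand
  side does not decrease when \<open>m w0\<close> is lowered to \<open>1/2\<close>, and the result is
  \<open>m \<ge> 1/2 + gain q\<close> (lemma \<open>half_plus_gain_le\<close>).

  To locate the maximum of the gain, expand \<open>ln (1 - q\<^sup>2)\<close>: then \<open>ln q\<close> cancels
  (\<open>gain_altdef\<close>), and the derivative of what remains is
  \<open>-((1 - q) ln (1 - q) + q ln (1 + q)) / ln 2\<close>. The bracket divided by \<open>q\<close> is strictly
  increasing (\<open>scaled_slope_strict_mono\<close>) and changes sign on the open unit interval
  (\<open>scaled_slope_zero\<close>). Hence it has exactly one zero, before which the gain strictly increases
  and after which it strictly decreases. At the zero, \<open>(1 - q) ln (1 - q) = - q ln (1 + q)\<close> turns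
  the gain into the closed form.
\<close>

lemma h_le_ln_2:
  assumes "x \<in> {0..1}"
  shows "h x \<le> ln 2"
proof (cases "x = 0 \<or> x = 1")
  case True
  then show ?thesis by (auto simp: h_def)
next
  case False
  with assms have x: "0 < x" "x < 1" by auto
  \<comment> \<open>The tangent of \<open>ln\<close> at 1, taken at \<open>1 / (2 t)\<close>: this is Gibbs' inequality against the
    uniform distribution on two points.\<close>
  have gibbs: "- t * ln t \<le> 1/2 - t + t * ln 2" if "t > 0" for t :: real
  proof -
    have "ln (1 / (2 * t)) \<le> 1 / (2 * t) - 1"
      using that by (intro ln_le_minus_one) auto
    then have "t * ln (1 / (2 * t)) \<le> t * (1 / (2 * t) - 1)"
      using that by (intro mult_left_mono) auto
    then show ?thesis
      using that by (simp add: ln_div ln_mult algebra_simps)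
  qed
  show ?thesis
    using gibbs[of x] gibbs[of "1 - x"] x by (simp add: h_def algebra_simps)
qed

lemma h_half: "h (1/2) = ln 2"
  by (simp add: h_def ln_div)

text \<open>The value \<open>r a x y\<close> is the convex combination of \<open>x y\<close> and \<open>min x y\<close> with weight
  \<open>a x * a y\<close> on the latter. This is what allows \<open>h_le_ln_2\<close> to bound the kernel.\<close>

lemma r_in_unit_interval:
  assumes "x \<in> {0..1}" "y \<in> {0..1}" "a x \<in> {0..1}" "a y \<in> {0..1}"
  shows "r a x y \<in> {0..1}"
proof -
  have le: "x * y \<le> min x y"
    using assms by (auto simp: mult_left_le mult_left_le_one_le)
  have a: "0 \<le> a x * a y" "a x * a y \<le> 1"
    using assms by (auto intro: mult_le_one)
  have "a x * a y * (min x y - x * y) \<le> min x y - x * y"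
    using le a by (intro mult_left_le_one_le) auto
  moreover have "0 \<le> a x * a y * (min x y - x * y)" "0 \<le> x * y" "min x y \<le> 1"
    using le a assms by auto
  ultimately show ?thesis unfolding r_def by auto
qed

text \<open>Each \<open>q\<close> gives its own lower bound on \<open>m\<close>; the theorem uses the best one. The hypotheses
  mix \<open>m\<close> with the split into \<open>w0\<close> and \<open>w4\<close>, and \<open>2 m w0 \<ge> 1\<close> is what eliminates the split.\<close>

lemma half_plus_gain_le:
  fixes a \<psi> :: "real \<Rightarrow> real" and w0 w4 m :: real
  assumes a: "\<And>x. x \<in> {0..1} \<Longrightarrow> a x \<in> {0..1}"
    and w: "w4 \<ge> 0" "w0 + w4 = 1" and m: "m > 0"
    and K: "\<And>x. x \<in> {0..1} \<Longrightarrow> K a x x \<ge> \<psi> x * \<psi> x"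
    and test: "\<And>x y. x \<in> {0..1} \<Longrightarrow> y \<in> {0..1} \<Longrightarrow>
           2 * m * (w0 * h (x * y) + w4 * (\<psi> x * \<psi> y)) \<ge> x * h y + y * h x"
    and q: "q \<in> {0..1}"
  shows "1/2 + gain q \<le> m"
proof -
  have "\<psi> 1 * \<psi> 1 \<le> 0"
    using K[of 1] by (simp add: K_def r_def h_def)
  then have "\<psi> 1 = 0"
    by (metis mult_eq_0_iff not_square_less_zero order.not_eq_order_implies_strict)
  \<comment> \<open>For every \<open>y\<close> the pair \<open>(1, y)\<close> gives \<open>h y \<le> 2 m w0 h y\<close>; any \<open>y\<close> with positive entropy
    lets \<open>h y\<close> be cancelled.\<close>
  then have "ln 2 \<le> 2 * (m * w0) * ln (2::real)"
    using test[of 1 "1/2"] h_half by (simp add: h_def[of 1])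
  then have w0: "1/2 \<le> m * w0"
    by simp
  have "\<psi> q * \<psi> q \<le> ln 2"
    using K[OF q] h_le_ln_2[OF r_in_unit_interval[of q q a]] q a[OF q]
    unfolding K_def by linarith
  then have "m * w4 * (\<psi> q * \<psi> q) \<le> m * w4 * ln 2"
    using w m by (intro mult_left_mono) auto
  then have "q * h q \<le> m * w0 * h (q\<^sup>2) + m * w4 * ln 2"
    using test[OF q q] by (simp add: algebra_simps power2_eq_square)
  also have "\<dots> = m * ln 2 - m * w0 * (ln 2 - h (q\<^sup>2))"
  proof -
    have "w4 = 1 - w0" using w by simp
    show ?thesis unfolding \<open>w4 = 1 - w0\<close> by (simp add: algebra_simps)
  qed
  also have "\<dots> \<le> m * ln 2 - 1/2 * (ln 2 - h (q\<^sup>2))"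
    using q w0 h_le_ln_2[of "q\<^sup>2"] by (intro diff_left_mono mult_right_mono) (auto simp: power_le_one)
  finally have "q * h q - 1/2 * h (q\<^sup>2) \<le> (m - 1/2) * ln 2"
    by (simp add: algebra_simps)
  then have "gain q \<le> m - 1/2"
    by (simp add: gain_def divide_le_eq)
  then show ?thesis by simp
qed

text \<open>In \<open>q h q - h (q\<^sup>2) / 2\<close> both parts contain \<open>- q\<^sup>2 ln q\<close>, so \<open>ln q\<close> drops out.\<close>

lemma gain_altdef:
  assumes "0 < q" "q < 1"
  shows "gain q = ((1 - q)\<^sup>2 * ln (1 - q) + (1 - q\<^sup>2) * ln (1 + q)) / (2 * ln 2)"
proof -
  have "1 - q\<^sup>2 = (1 - q) * (1 + q)" by (simp add: algebra_simps power2_eq_square)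
  then have "ln (1 - q\<^sup>2) = ln (1 - q) + ln (1 + q)"
    using assms by (simp add: ln_mult)
  moreover have "ln (q\<^sup>2) = 2 * ln q"
    using assms by (simp add: ln_realpow)
  ultimately show ?thesis
    by (simp add: gain_def h_def field_simps power2_eq_square)
qed

text \<open>The negated derivative of \<open>ln 2 * gain\<close>, divided by \<open>q\<close>. The division is what makes it
  monotone: the undivided \<open>(1 - q) ln (1 - q) + q ln (1 + q)\<close> starts at 0, decreases, and only
  then increases.\<close>

definition scaled_slope :: "real \<Rightarrow> real" where
  "scaled_slope q = (1 / q - 1) * ln (1 - q) + ln (1 + q)"

lemma critical_eq_scaled_slope:
  assumes "q \<noteq> 0"
  shows "(1 - q) * ln (1 - q) + q * ln (1 + q) = q * scaled_slope q"
  using assms by (simp add: scaled_slope_def field_simps)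

lemma has_real_derivative_gain:
  assumes "0 < q" "q < 1"
  shows "(gain has_real_derivative - (q * scaled_slope q) / ln 2) (at q)"
proof -
  have nz: "1 - q \<noteq> 0" "1 + q \<noteq> 0" using assms by auto
  have "((\<lambda>q. (1 - q)\<^sup>2 * ln (1 - q) + (1 - q\<^sup>2) * ln (1 + q)) has_real_derivative
        - (2 * (1 - q)) * ln (1 - q) - (1 - q)\<^sup>2 / (1 - q)
         - 2 * q * ln (1 + q) + (1 - q\<^sup>2) / (1 + q)) (at q)"
    using assms by (auto intro!: derivative_eq_intros simp: algebra_simps add_divide_distrib diff_divide_distrib)
  also have "- (2 * (1 - q)) * ln (1 - q) - (1 - q)\<^sup>2 / (1 - q)
         - 2 * q * ln (1 + q) + (1 - q\<^sup>2) / (1 + q) = - 2 * (q * scaled_slope q)"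
  proof -
    have "(1 - q)\<^sup>2 / (1 - q) = 1 - q"
      using nz by (simp add: power2_eq_square)
    moreover have "(1 - q\<^sup>2) / (1 + q) = 1 - q"
      using nz by (simp add: field_simps power2_eq_square)
    ultimately show ?thesis
      using assms by (simp add: critical_eq_scaled_slope[symmetric] algebra_simps)
  qed
  finally have "((\<lambda>q. ((1 - q)\<^sup>2 * ln (1 - q) + (1 - q\<^sup>2) * ln (1 + q)) / (2 * ln 2))
      has_real_derivative - 2 * (q * scaled_slope q) / (2 * ln 2)) (at q)"
    by (rule DERIV_cdivide)
  then have "((\<lambda>q. ((1 - q)\<^sup>2 * ln (1 - q) + (1 - q\<^sup>2) * ln (1 + q)) / (2 * ln 2))
      has_real_derivative - (q * scaled_slope q) / ln 2) (at q)"
    by simp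
  then show ?thesis
    by (rule has_field_derivative_transform_within_open[where S = "{0<..<1}"])
      (use assms in \<open>auto simp: gain_altdef\<close>)
qed

text \<open>The derivative at \<open>t\<close> is \<open>(- ln (1 - t) - t / (1 + t)) / t\<^sup>2\<close>, which is positive because
  \<open>- ln (1 - t) \<ge> t > t / (1 + t)\<close>.\<close>

lemma scaled_slope_strict_mono:
  assumes "0 < p" "p < q" "q < 1"
  shows "scaled_slope p < scaled_slope q"
proof (rule DERIV_pos_imp_increasing[OF \<open>p < q\<close>])
  fix t assume "p \<le> t" "t \<le> q"
  then have t: "0 < t" "t < 1" using assms by auto
  have "(scaled_slope has_real_derivative
      - (1 / t\<^sup>2) * ln (1 - t) - (1 / t - 1) / (1 - t) + 1 / (1 + t)) (at t)"
    unfolding scaled_slope_def[abs_def] using t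
    by (rule_tac derivative_eq_intros refl | simp add: power2_eq_square)+
  also have "- (1 / t\<^sup>2) * ln (1 - t) - (1 / t - 1) / (1 - t) + 1 / (1 + t)
      = (- ln (1 - t) - t / (1 + t)) / t\<^sup>2"
  proof -
    have nz: "t \<noteq> 0" "1 - t \<noteq> 0" "1 + t \<noteq> 0" using t by auto
    have "(1 / t - 1) / (1 - t) = 1 / t"
      using nz by (simp add: field_simps)
    moreover have "1 / t - 1 / (1 + t) = t / (1 + t) / t\<^sup>2"
      using nz by (simp add: diff_frac_eq power2_eq_square)
    ultimately show ?thesis by (simp add: diff_divide_distrib)
  qed
  finally have "(scaled_slope has_real_derivative (- ln (1 - t) - t / (1 + t)) / t\<^sup>2) (at t)" .
  moreover have "0 < - ln (1 - t) - t / (1 + t)"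
  proof -
    have "t \<le> - ln (1 - t)" using ln_le_minus_one[of "1 - t"] t by simp
    moreover have "t / (1 + t) < t" using t by (simp add: divide_less_eq)
    ultimately show ?thesis by linarith
  qed
  ultimately show "\<exists>y. (scaled_slope has_real_derivative y) (at t) \<and> 0 < y"
    using t by (meson divide_pos_pos zero_less_power)
qed

text \<open>The sign change lies between \<open>1/2\<close> and \<open>3/4\<close>. At these points the values, up to a positive
  integer factor, are logarithms of the rationals \<open>3/4 < 1\<close> and \<open>343/256 > 1\<close>, so their signs
  need no numerical estimate.\<close>

lemma scaled_slope_zero:
  obtains s where "0 < s" "s < 1" "scaled_slope s = 0"
proof -
  have "scaled_slope (1/2) = ln (3/4)"
    using ln_mult[of "1/2" "3/2 :: real"] by (simp add: scaled_slope_def)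
  then have neg: "scaled_slope (1/2) \<le> 0" by simp
  have "3 * scaled_slope (3/4) = ln (1/4) + 3 * ln (7/4)"
    by (simp add: scaled_slope_def)
  also have "\<dots> = ln (1/4 * (7/4)^3)"
    by (subst ln_mult) (auto simp: ln_realpow)
  also have "\<dots> \<ge> 0" by (simp add: power3_eq_cube)
  finally have pos: "0 \<le> scaled_slope (3/4)" by simp
  have "continuous_on {1/2..3/4} scaled_slope"
    unfolding scaled_slope_def[abs_def] by (intro continuous_intros) auto
  then obtain s where "1/2 \<le> s" "s \<le> 3/4" "scaled_slope s = 0"
    using IVT'[of scaled_slope "1/2" 0 "3/4"] neg pos by auto
  then show ?thesis using that[of s] by simp
qed

text \<open>The derivative of the gain has the sign of \<open>- scaled_slope\<close>, which strict monotonicity makes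
  positive to the left of the zero and negative to the right.\<close>

lemma gain_less_at_zero:
  assumes s: "0 < s" "s < 1" "scaled_slope s = 0" and q: "0 < q" "q < 1" "q \<noteq> s"
  shows "gain q < gain s"
proof -
  have cont: "continuous_on {u..v} gain" if "0 < u" "v < 1" for u v
    using that by (intro continuous_at_imp_continuous_on)
      (auto intro!: DERIV_isCont[OF has_real_derivative_gain])
  show ?thesis
  proof (cases "q < s")
    case True
    then show ?thesis
    proof (rule DERIV_pos_imp_increasing_open)
      fix t assume t: "q < t" "t < s"
      then have "t * scaled_slope t < 0"
        using scaled_slope_strict_mono[of t s] s q by (auto intro: mult_pos_neg)
      then show "\<exists>y. (gain has_real_derivative y) (at t) \<and> 0 < y"
        using has_real_derivative_gain[of t] t s q
        by (intro exI[of _ "- (t * scaled_slope t) / ln 2"] conjI divide_pos_pos) auto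
    qed (use cont s q in auto)
  next
    case False
    with q have "s < q" by simp
    then show ?thesis
    proof (rule DERIV_neg_imp_decreasing_open)
      fix t assume t: "s < t" "t < q"
      then have "0 < t * scaled_slope t"
        using scaled_slope_strict_mono[of s t] s q by auto
      then show "\<exists>y. (gain has_real_derivative y) (at t) \<and> y < 0"
        using has_real_derivative_gain[of t] t s q
        by (intro exI[of _ "- (t * scaled_slope t) / ln 2"] conjI divide_neg_pos) auto
    qed (use cont s q in auto)
  qed
qed

lemma gain_at_zero:
  assumes "0 < s" "s < 1" "scaled_slope s = 0"
  shows "gain s = (1 - s) * ln (1 + s) / (2 * ln 2)"
proof -
  have "(1 - s) * ln (1 - s) = - s * ln (1 + s)"
    using critical_eq_scaled_slope[of s] assms by simp
  then have "(1 - s)\<^sup>2 * ln (1 - s) = (1 - s) * (- s * ln (1 + s))"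
    by (simp add: power2_eq_square mult.assoc)
  then have "(1 - s)\<^sup>2 * ln (1 - s) + (1 - s\<^sup>2) * ln (1 + s) = (1 - s) * ln (1 + s)"
    by (simp add: algebra_simps power2_eq_square)
  then show ?thesis using assms by (simp add: gain_altdef)
qed

theorem proposition4p1:
  fixes a \<psi> :: "real \<Rightarrow> real" and w0 w4 m :: real
  assumes "\<And>x. x \<in> {0..1} \<Longrightarrow> a x \<in> {0..1}"
    and "\<And>x. x \<in> {0..1} \<Longrightarrow> \<psi> x \<ge> 0"
    and "w0 \<ge> 0" and "w4 \<ge> 0" and "w0 + w4 = 1" and "m > 0"
    and "\<And>x y. x \<in> {0..1} \<Longrightarrow> y \<in> {0..1} \<Longrightarrow> K a x y \<ge> \<psi> x * \<psi> y"
    and "\<And>x y. x \<in> {0..1} \<Longrightarrow> y \<in> {0..1} \<Longrightarrow>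
           2 * m * (w0 * h (x * y) + w4 * (\<psi> x * \<psi> y)) \<ge> x * h y + y * h x"
  shows "1 - m \<le> C_star \<and>
    (\<exists>q\<^sub>s\<in>{0<..<1}.
       (\<forall>q\<in>{0<..<1}. (1 - q) * ln (1 - q) + q * ln (1 + q) = 0 \<longleftrightarrow> q = q\<^sub>s) \<and>
       (\<forall>q. is_arg_max gain (\<lambda>p. p \<in> {0<..<1}) q \<longleftrightarrow> q = q\<^sub>s) \<and>
       C_star = 1/2 - (1 - q\<^sub>s) * ln (1 + q\<^sub>s) / (2 * ln 2))"
proof -
  obtain s where s: "0 < s" "s < 1" "scaled_slope s = 0"
    by (rule scaled_slope_zero)
  have less: "gain q < gain s" if "q \<in> {0<..<1}" "q \<noteq> s" for q
    using gain_less_at_zero[OF s] that by simp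
  have "(SUP q\<in>{0<..<1}. gain q) = gain s"
  proof (rule cSup_eq_maximum)
    show "x \<le> gain s" if "x \<in> gain ` {0<..<1}" for x
      using that less less_eq_real_def by blast
  qed (use s in auto)
  then have C: "C_star = 1/2 - gain s"
    by (simp add: C_star_def)
  have "1/2 + gain s \<le> m"
    using assms s by (intro half_plus_gain_le[of a w4 w0 m \<psi>]) auto
  then have bound: "1 - m \<le> C_star"
    using C by simp
  have root: "(1 - q) * ln (1 - q) + q * ln (1 + q) = 0 \<longleftrightarrow> q = s" if "q \<in> {0<..<1}" for q
    using that s scaled_slope_strict_mono[of q s] scaled_slope_strict_mono[of s q]
    by (cases q s rule: linorder_cases) (auto simp: critical_eq_scaled_slope)
  have argmax: "is_arg_max gain (\<lambda>p. p \<in> {0<..<1}) q \<longleftrightarrow> q = s" for q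
    using s less unfolding is_arg_max_def
    by (metis greaterThanLessThan_iff less_asym less_irrefl)
  show ?thesis
    using s bound root argmax C gain_at_zero[OF s] by (intro conjI bexI[of _ s]) auto
qed

end
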